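(* The following two assertions are equivalent. (A) For every non-empty compact convex subset $X$ of a Hausdorff topological vector space and every function $f:X\times X\to\mathbb{R}$ such that (i) for each $y\in X$, $f(\cdot,y)$ is lower semicontinuous, and (ii) for each $x\in X$, $f(x,\cdot)$ is quasi-concave, one has \[ \min_{x\in X}\sup_{y\in X} f(x,y)\leq \sup_{x\in X} f(x,x). \] (B) For every non-empty compact convex subset $X$ of a Hausdorff topological vector space and all functions $f,g:X\times X\to\mathbb{R}$ such that (i) $f(x,y)\leq g(x,y)$ for all $x,y\in X$, (ii) for each $y\in X$, $f(\cdot,y)$ is lower semicontinuous, (iii) for each $x\in X$, $g(x,\cdot)$ is quasi-concave, and (iv) $g(x,x)\leq 0$ for all $x\in X$, there exists $x_0\in X$ such that $f(x_0,y)\leq 0$ for all $y\in X$.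
   Context: Vector spaces are real. Assertion (A) is Ky Fan's minimax inequality; suprema are taken in $\mathbb{R}\cup\{+\infty\}$. A function $h:X\to\mathbb{R}$ on a convex set $X$ is quasi-concave if $\{x\in X: h(x)\geq\lambda\}$ is convex for every $\lambda\in\mathbb{R}$. *)

theory Defs
  imports "HOL-Analysis.Analysis" "HOL-Algebra.Module"
begin

definition real_field :: "real ring" where
  "real_field = \<lparr>carrier = UNIV, mult = (*), one = 1, zero = 0, add = (+)\<rparr>"

(* Explicit carriers, since the assertions quantify over all spaces inside one formula.
   A vector space is a module over a field; the ring multiplication and unit that the
   record of V also contains are unconstrained and unused. *)
locale hausdorff_tvs = Module.module real_field V for V (structure) +
  fixes T :: "'a topology"
  assumes topspace_eq: "topspace T = carrier V"
    and hausdorff: "Hausdorff_space T"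
    and continuous_add: "continuous_map (prod_topology T T) T (\<lambda>(x, y). x \<oplus> y)"
    and continuous_smult:
      "continuous_map (prod_topology euclideanreal T) T (\<lambda>(a, x). a \<odot> x)"

definition convex_in :: "(real, 'a) module \<Rightarrow> 'a set \<Rightarrow> bool" where
  "convex_in V S \<longleftrightarrow> S \<subseteq> carrier V \<and>
     (\<forall>x\<in>S. \<forall>y\<in>S. \<forall>u\<ge>0. \<forall>v\<ge>0. u + v = 1 \<longrightarrow> u \<odot>\<^bsub>V\<^esub> x \<oplus>\<^bsub>V\<^esub> v \<odot>\<^bsub>V\<^esub> y \<in> S)"

definition quasi_concave_on :: "(real, 'a) module \<Rightarrow> 'a set \<Rightarrow> ('a \<Rightarrow> real) \<Rightarrow> bool" where
  "quasi_concave_on V X h \<longleftrightarrow> (\<forall>l. convex_in V {x \<in> X. h x \<ge> l})"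

definition lower_semicontinuous_map :: "'a topology \<Rightarrow> ('a \<Rightarrow> real) \<Rightarrow> bool" where
  "lower_semicontinuous_map T h \<longleftrightarrow> (\<forall>l. openin T {x \<in> topspace T. h x > l})"

end

theory Submission
  imports Defs
begin

text \<open>
  From (A) to (B): replace \<open>f\<close> by the quasi-concave envelope \<open>h\<close> of \<open>f\<close> in its second argument.
  Since \<open>g x\<close> is a quasi-concave function above \<open>f x\<close>, it lies above \<open>h x\<close>, so that
  \<open>f \<le> h \<le> g\<close>; in particular \<open>h\<close> is real-valued and at most \<open>0\<close> on the diagonal. The point is
  that \<open>h\<close> stays lower semicontinuous in its first argument: a point of a convex hull is already in the
  hull of a finite subset, so \<open>h\<close> is a supremum of minima of finitely many functions \<open>\<lambda>x. f x z\<close>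
  (lemma \<open>less_envelope_iff\<close>). Thus (A) applies to \<open>h\<close>, and the minimizer that it gives is the
  required point because \<open>f \<le> h\<close>.

  From (B) to (A): if the supremum over the diagonal is infinite, only the existence of a minimizer
  is at stake, and a lower semicontinuous function on a compact space has one. If it is a real
  number \<open>m\<close>, then (B) with \<open>f - m\<close> in place of both functions gives a point at which the supremum
  is at most \<open>m\<close>, and the minimum can only be smaller.
\<close>

section \<open>Convex hulls\<close>

definition hull_in :: "(real, 'a) module \<Rightarrow> 'a set \<Rightarrow> 'a set" where
  "hull_in V F = \<Inter>{C. convex_in V C \<and> F \<subseteq> C}"

lemma hull_in_subset: "convex_in V C \<Longrightarrow> F \<subseteq> C \<Longrightarrow> hull_in V F \<subseteq> C"
  by (auto simp: hull_in_def)

lemma subset_hull_in: "F \<subseteq> hull_in V F"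
  by (auto simp: hull_in_def)

lemma hull_in_mono: "F \<subseteq> G \<Longrightarrow> hull_in V F \<subseteq> hull_in V G"
  by (auto simp: hull_in_def)

lemma hull_in_empty: "hull_in V {} = {}"
  by (auto simp: hull_in_def convex_in_def)

lemma hull_in_combination:
  assumes "x \<in> hull_in V F" "y \<in> hull_in V F" "0 \<le> u" "0 \<le> v" "u + v = 1"
  shows "u \<odot>\<^bsub>V\<^esub> x \<oplus>\<^bsub>V\<^esub> v \<odot>\<^bsub>V\<^esub> y \<in> hull_in V F"
  using assms unfolding hull_in_def convex_in_def by simp

section \<open>The quasi-concave envelope\<close>

text \<open>
  The least quasi-concave majorant on \<open>X\<close>. Finite sets suffice in a vector space, and insisting on
  them is what makes the envelope semicontinuous in a parameter.
\<close>
definition envelope :: "(real, 'a) module \<Rightarrow> 'a set \<Rightarrow> ('a \<Rightarrow> real) \<Rightarrow> 'a \<Rightarrow> real" where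
  "envelope V X p y = Sup {l. \<exists>F. finite F \<and> F \<subseteq> X \<and> y \<in> hull_in V F \<and> (\<forall>z\<in>F. l \<le> p z)}"

context
  fixes V :: "(real, 'a) module" and X :: "'a set" and p q :: "'a \<Rightarrow> real"
  assumes le: "\<And>y. y \<in> X \<Longrightarrow> p y \<le> q y" and qc: "quasi_concave_on V X q"
begin

text \<open>
  A superlevel set of \<open>q\<close> is convex and contains the corresponding one of \<open>p\<close>, hence also its hull.
  This bounds the set whose supremum is the envelope.
\<close>
lemma hull_in_bound:
  assumes "F \<subseteq> X" "y \<in> hull_in V F" "\<forall>z\<in>F. l \<le> p z"
  shows "l \<le> q y"
proof -
  have "F \<subseteq> {z \<in> X. l \<le> q z}" using assms le by force
  moreover have "convex_in V {z \<in> X. l \<le> q z}" using qc by (simp add: quasi_concave_on_def)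
  ultimately show ?thesis using hull_in_subset assms(2) by blast
qed

lemma bdd_above_envelope:
  "bdd_above {l. \<exists>F. finite F \<and> F \<subseteq> X \<and> y \<in> hull_in V F \<and> (\<forall>z\<in>F. l \<le> p z)}"
  using hull_in_bound by (intro bdd_aboveI[of _ "q y"]) blast

lemma le_envelope:
  assumes "finite F" "F \<subseteq> X" "y \<in> hull_in V F" "\<forall>z\<in>F. l \<le> p z"
  shows "l \<le> envelope V X p y"
  unfolding envelope_def using assms by (intro cSup_upper bdd_above_envelope) blast

lemma self_le_envelope: "y \<in> X \<Longrightarrow> p y \<le> envelope V X p y"
  using subset_hull_in[of "{y}" V] by (intro le_envelope[of "{y}"]) auto

lemma envelope_set_nonempty:
  assumes "y \<in> X"
  shows "{l. \<exists>F. finite F \<and> F \<subseteq> X \<and> y \<in> hull_in V F \<and> (\<forall>z\<in>F. l \<le> p z)} \<noteq> {}"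
proof -
  have "finite {y} \<and> {y} \<subseteq> X \<and> y \<in> hull_in V {y} \<and> (\<forall>z\<in>{y}. p y \<le> p z)"
    using assms subset_hull_in[of "{y}" V] by auto
  then show ?thesis by blast
qed

lemma envelope_le:
  assumes "y \<in> X"
  shows "envelope V X p y \<le> q y"
  unfolding envelope_def using hull_in_bound
  by (intro cSup_least envelope_set_nonempty assms) blast

text \<open>
  Passing to strict inequalities turns the supremum into a mere existence statement: on a finite
  set, which is non-empty because its hull contains \<open>y\<close>, the minimum of \<open>p\<close> exceeds \<open>l\<close> as soon as
  all values do.
\<close>
lemma less_envelope_iff:
  assumes "y \<in> X"
  shows "l < envelope V X p y \<longleftrightarrow>
    (\<exists>F. finite F \<and> F \<subseteq> X \<and> y \<in> hull_in V F \<and> (\<forall>z\<in>F. l < p z))"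
proof
  assume "l < envelope V X p y"
  then show "\<exists>F. finite F \<and> F \<subseteq> X \<and> y \<in> hull_in V F \<and> (\<forall>z\<in>F. l < p z)"
    unfolding envelope_def
    by (subst (asm) less_cSup_iff[OF envelope_set_nonempty[OF assms] bdd_above_envelope])
      (auto intro: less_le_trans)
next
  assume "\<exists>F. finite F \<and> F \<subseteq> X \<and> y \<in> hull_in V F \<and> (\<forall>z\<in>F. l < p z)"
  then obtain F where F: "finite F" "F \<subseteq> X" "y \<in> hull_in V F" "\<forall>z\<in>F. l < p z" by blast
  then have "F \<noteq> {}" using hull_in_empty[of V] by auto
  then have "l < Min (p ` F)" using F by simp
  also have "Min (p ` F) \<le> envelope V X p y" using F by (intro le_envelope) auto
  finally show "l < envelope V X p y" .
qed

lemma quasi_concave_on_envelope: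
  assumes X: "convex_in V X"
  shows "quasi_concave_on V X (envelope V X p)"
  unfolding quasi_concave_on_def convex_in_def
proof (intro allI conjI ballI impI)
  fix l
  show "{x \<in> X. l \<le> envelope V X p x} \<subseteq> carrier V" using X by (auto simp: convex_in_def)
next
  fix l y1 y2 and u v :: real
  assume y: "y1 \<in> {x \<in> X. l \<le> envelope V X p x}" "y2 \<in> {x \<in> X. l \<le> envelope V X p x}"
    and uv: "0 \<le> u" "0 \<le> v" "u + v = 1"
  let ?w = "u \<odot>\<^bsub>V\<^esub> y1 \<oplus>\<^bsub>V\<^esub> v \<odot>\<^bsub>V\<^esub> y2"
  have w: "?w \<in> X" using X y uv by (simp add: convex_in_def)
  have "k \<le> envelope V X p ?w" if "k < l" for k
  proof -
    have "y1 \<in> X" "y2 \<in> X" "k < envelope V X p y1" "k < envelope V X p y2"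
      using y that by auto
    then obtain F G where F: "finite F" "F \<subseteq> X" "y1 \<in> hull_in V F" "\<forall>z\<in>F. k < p z"
      and G: "finite G" "G \<subseteq> X" "y2 \<in> hull_in V G" "\<forall>z\<in>G. k < p z"
      by (auto simp: less_envelope_iff)
    have "y1 \<in> hull_in V (F \<union> G)" "y2 \<in> hull_in V (F \<union> G)"
      using F(3) G(3) hull_in_mono[of F "F \<union> G" V] hull_in_mono[of G "F \<union> G" V] by auto
    then have "?w \<in> hull_in V (F \<union> G)" using uv by (rule hull_in_combination)
    then show ?thesis using F G by (intro le_envelope[of "F \<union> G"]) (auto intro: less_imp_le)
  qed
  then show "?w \<in> {x \<in> X. l \<le> envelope V X p x}" using w by (auto intro: dense_le)
qed

end

lemma lower_semicontinuous_map_envelope: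
  assumes top: "topspace S = X"
    and le: "\<And>x y. x \<in> X \<Longrightarrow> y \<in> X \<Longrightarrow> f x y \<le> g x y"
    and qc: "\<And>x. x \<in> X \<Longrightarrow> quasi_concave_on V X (g x)"
    and lsc: "\<And>y. y \<in> X \<Longrightarrow> lower_semicontinuous_map S (\<lambda>x. f x y)"
    and y: "y \<in> X"
  shows "lower_semicontinuous_map S (\<lambda>x. envelope V X (f x) y)"
  unfolding lower_semicontinuous_map_def
proof
  fix l
  let ?I = "{F. finite F \<and> F \<subseteq> X \<and> y \<in> hull_in V F}"
  have "{x \<in> topspace S. l < envelope V X (f x) y} =
      (\<Union>F\<in>?I. {x \<in> topspace S. \<forall>z\<in>F. l < f x z})"
    using less_envelope_iff[OF le qc y] top by auto
  moreover have "openin S {x \<in> topspace S. \<forall>z\<in>F. l < f x z}" if "F \<in> ?I" for F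
  proof -
    have "openin S ((\<Inter>z\<in>F. {x \<in> topspace S. l < f x z}) \<inter> topspace S)"
      using that lsc by (intro openin_INT) (auto simp: lower_semicontinuous_map_def)
    moreover have "(\<Inter>z\<in>F. {x \<in> topspace S. l < f x z}) \<inter> topspace S =
        {x \<in> topspace S. \<forall>z\<in>F. l < f x z}"
      by auto
    ultimately show ?thesis by simp
  qed
  ultimately show "openin S {x \<in> topspace S. l < envelope V X (f x) y}" by auto
qed

section \<open>Minimizers on compact spaces\<close>

text \<open>
  If no minimizer exists, then every point has a value exceeding some level \<open>c\<close> which itself exceeds
  another value. The sets \<open>{\<phi> > c}\<close> for such \<open>c\<close> form an open cover; in a finite subcover, a value
  below the least of the levels is attained at an uncovered point.
\<close>
lemma lower_semicontinuous_attains_min: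
  fixes \<phi> :: "'a \<Rightarrow> ereal"
  assumes "compact_space S" "topspace S \<noteq> {}"
    and op: "\<And>c::real. openin S {x \<in> topspace S. ereal c < \<phi> x}"
  shows "\<exists>x0. is_arg_min \<phi> (\<lambda>x. x \<in> topspace S) x0"
proof (rule ccontr)
  assume "\<not> ?thesis"
  then have no: "\<exists>x'\<in>topspace S. \<phi> x' < \<phi> x" if "x \<in> topspace S" for x
    using that by (auto simp: is_arg_min_def)
  define C where "C = {c::real. \<exists>x\<in>topspace S. \<phi> x < ereal c}"
  define U where "U c = {x \<in> topspace S. ereal c < \<phi> x}" for c :: real
  have "topspace S \<subseteq> \<Union>(U ` C)"
  proof
    fix x assume x: "x \<in> topspace S"
    then obtain x' where x': "x' \<in> topspace S" "\<phi> x' < \<phi> x" using no by blast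
    then obtain c where "\<phi> x' < ereal c" "ereal c < \<phi> x" using ereal_dense2 by blast
    then show "x \<in> \<Union>(U ` C)" using x x' by (auto simp: C_def U_def)
  qed
  moreover have "\<And>W. W \<in> U ` C \<Longrightarrow> openin S W" using op by (auto simp: U_def)
  ultimately obtain \<F> where \<F>: "finite \<F>" "\<F> \<subseteq> U ` C" "topspace S \<subseteq> \<Union>\<F>"
    using compact_space_alt assms(1) by metis
  then obtain D where D: "D \<subseteq> C" "finite D" "\<F> = U ` D" by (meson finite_subset_image)
  have ne: "D \<noteq> {}" using D \<F> assms(2) by auto
  then have "Min D \<in> C" using D Min_in by blast
  then obtain x where x: "x \<in> topspace S" "\<phi> x < ereal (Min D)" by (auto simp: C_def)
  then obtain d where d: "d \<in> D" "ereal d < \<phi> x" using \<F> D by (auto simp: U_def)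
  then have "ereal (Min D) \<le> ereal d" using D by simp
  then show False using x d by (meson leD less_trans order_less_le_trans)
qed

text \<open>
  A supremum of lower semicontinuous functions is lower semicontinuous, so the supremum in (A) is
  attained as a minimum.
\<close>
lemma arg_min_SUP_exists:
  fixes f :: "'a \<Rightarrow> 'b \<Rightarrow> real"
  assumes "compact_space S" "topspace S \<noteq> {}"
    and lsc: "\<And>y. y \<in> Y \<Longrightarrow> lower_semicontinuous_map S (\<lambda>x. f x y)"
  shows "\<exists>x0. is_arg_min (\<lambda>x. SUP y\<in>Y. ereal (f x y)) (\<lambda>x. x \<in> topspace S) x0"
proof (rule lower_semicontinuous_attains_min[OF assms(1,2)])
  fix c :: real
  have "{x \<in> topspace S. ereal c < (SUP y\<in>Y. ereal (f x y))} =
      (\<Union>y\<in>Y. {x \<in> topspace S. c < f x y})"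
    by (auto simp: less_SUP_iff)
  then show "openin S {x \<in> topspace S. ereal c < (SUP y\<in>Y. ereal (f x y))}"
    using lsc by (auto simp: lower_semicontinuous_map_def)
qed

lemma lower_semicontinuous_map_diff_const:
  assumes "lower_semicontinuous_map S h"
  shows "lower_semicontinuous_map S (\<lambda>x. h x - m)"
  using assms by (simp add: lower_semicontinuous_map_def less_diff_eq)

lemma quasi_concave_on_diff_const:
  assumes "quasi_concave_on V X h"
  shows "quasi_concave_on V X (\<lambda>x. h x - m)"
  using assms by (simp add: quasi_concave_on_def le_diff_eq)

section \<open>The equivalence\<close>

theorem mainTheorem5:
  shows
    "(\<forall>(V :: (real, 'a) module) T X (f :: 'a \<Rightarrow> 'a \<Rightarrow> real).
        hausdorff_tvs V T \<and> X \<noteq> {} \<and> compactin T X \<and> convex_in V X \<and>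
        (\<forall>y\<in>X. lower_semicontinuous_map (subtopology T X) (\<lambda>x. f x y)) \<and>
        (\<forall>x\<in>X. quasi_concave_on V X (\<lambda>y. f x y)) \<longrightarrow>
        (\<exists>x0. is_arg_min (\<lambda>x. SUP y\<in>X. ereal (f x y)) (\<lambda>x. x \<in> X) x0 \<and>
              (SUP y\<in>X. ereal (f x0 y)) \<le> (SUP x\<in>X. ereal (f x x))))
     \<longleftrightarrow>
     (\<forall>(V :: (real, 'a) module) T X (f :: 'a \<Rightarrow> 'a \<Rightarrow> real) (g :: 'a \<Rightarrow> 'a \<Rightarrow> real).
        hausdorff_tvs V T \<and> X \<noteq> {} \<and> compactin T X \<and> convex_in V X \<and>
        (\<forall>x\<in>X. \<forall>y\<in>X. f x y \<le> g x y) \<and>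
        (\<forall>y\<in>X. lower_semicontinuous_map (subtopology T X) (\<lambda>x. f x y)) \<and>
        (\<forall>x\<in>X. quasi_concave_on V X (\<lambda>y. g x y)) \<and>
        (\<forall>x\<in>X. g x x \<le> 0) \<longrightarrow>
        (\<exists>x0\<in>X. \<forall>y\<in>X. f x0 y \<le> 0))"
  (is "?A \<longleftrightarrow> ?B")
proof
  assume A: ?A
  show ?B
  proof (intro allI impI, elim conjE)
    fix V :: "(real, 'a) module" and T X and f g :: "'a \<Rightarrow> 'a \<Rightarrow> real"
    assume V: "hausdorff_tvs V T" "X \<noteq> {}" "compactin T X" "convex_in V X"
      and fg: "\<forall>x\<in>X. \<forall>y\<in>X. f x y \<le> g x y"
      and lsc: "\<forall>y\<in>X. lower_semicontinuous_map (subtopology T X) (\<lambda>x. f x y)"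
      and qc: "\<forall>x\<in>X. quasi_concave_on V X (\<lambda>y. g x y)"
      and diag: "\<forall>x\<in>X. g x x \<le> 0"
    let ?h = "\<lambda>x. envelope V X (f x)"
    have top: "topspace (subtopology T X) = X"
      using compactin_subset_topspace[OF V(3)] by (rule topspace_subtopology_subset)
    have le: "f x y \<le> g x y" if "x \<in> X" "y \<in> X" for x y using fg that by blast
    have qc': "quasi_concave_on V X (g x)" if "x \<in> X" for x using qc that by blast
    have "\<forall>y\<in>X. lower_semicontinuous_map (subtopology T X) (\<lambda>x. ?h x y)"
      using lower_semicontinuous_map_envelope[where f = f and g = g, OF top le qc'] lsc by blast
    moreover have "\<forall>x\<in>X. quasi_concave_on V X (\<lambda>y. ?h x y)"
      using quasi_concave_on_envelope[where p = "f x" and q = "g x" for x, OF le qc' V(4)] by blast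
    ultimately obtain x0
      where x0: "is_arg_min (\<lambda>x. SUP y\<in>X. ereal (?h x y)) (\<lambda>x. x \<in> X) x0"
        "(SUP y\<in>X. ereal (?h x0 y)) \<le> (SUP x\<in>X. ereal (?h x x))"
      using A[rule_format, of V T X ?h] V by blast
    have x0X: "x0 \<in> X" using x0(1) by (simp add: is_arg_min_def)
    have "?h x x \<le> 0" if "x \<in> X" for x
      using envelope_le[where p = "f x" and q = "g x" for x, OF le qc'] diag that by (meson order_trans)
    then have "(SUP x\<in>X. ereal (?h x x)) \<le> 0" by (intro SUP_least) simp
    then have "(SUP y\<in>X. ereal (?h x0 y)) \<le> 0" using x0(2) by (rule order_trans[rotated])
    then have "?h x0 y \<le> 0" if "y \<in> X" for y using that by (simp add: SUP_le_iff)
    then have "\<forall>y\<in>X. f x0 y \<le> 0"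
      using self_le_envelope[where p = "f x" and q = "g x" for x, OF le qc'] x0X by (meson order_trans)
    then show "\<exists>x0\<in>X. \<forall>y\<in>X. f x0 y \<le> 0" using x0X by blast
  qed
next
  assume B: ?B
  show ?A
  proof (intro allI impI, elim conjE)
    fix V :: "(real, 'a) module" and T X and f :: "'a \<Rightarrow> 'a \<Rightarrow> real"
    assume V: "hausdorff_tvs V T" "X \<noteq> {}" "compactin T X" "convex_in V X"
      and lsc: "\<forall>y\<in>X. lower_semicontinuous_map (subtopology T X) (\<lambda>x. f x y)"
      and qc: "\<forall>x\<in>X. quasi_concave_on V X (\<lambda>y. f x y)"
    let ?s = "SUP x\<in>X. ereal (f x x)"
    have top: "topspace (subtopology T X) = X"
      using compactin_subset_topspace[OF V(3)] by (rule topspace_subtopology_subset)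
    have cpt: "compact_space (subtopology T X)" using V(3) by (rule compact_space_subtopology)
    have "\<exists>x1. is_arg_min (\<lambda>x. SUP y\<in>X. ereal (f x y)) (\<lambda>x. x \<in> X) x1"
      using arg_min_SUP_exists[of "subtopology T X" X f, unfolded top, OF cpt V(2)] lsc by blast
    then obtain x1 where x1: "is_arg_min (\<lambda>x. SUP y\<in>X. ereal (f x y)) (\<lambda>x. x \<in> X) x1" ..
    have "(SUP y\<in>X. ereal (f x1 y)) \<le> ?s"
    proof (cases ?s)
      case (real m)
      have diag: "f x x \<le> m" if "x \<in> X" for x
        using SUP_upper[OF that, of "\<lambda>x. ereal (f x x)"] real by simp
      obtain x0 where x0: "x0 \<in> X" "\<forall>y\<in>X. f x0 y - m \<le> 0"
      proof -
        have "\<forall>y\<in>X. lower_semicontinuous_map (subtopology T X) (\<lambda>x. f x y - m)"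
          using lsc by (intro ballI lower_semicontinuous_map_diff_const) blast
        moreover have "\<forall>x\<in>X. quasi_concave_on V X (\<lambda>y. f x y - m)"
          using qc by (intro ballI quasi_concave_on_diff_const) blast
        moreover have "\<forall>x\<in>X. f x x - m \<le> 0" using diag by simp
        ultimately have "\<exists>x0\<in>X. \<forall>y\<in>X. f x0 y - m \<le> 0"
          using V by (intro B[rule_format, of V T X _ "\<lambda>x y. f x y - m"]) simp
        then show ?thesis using that by blast
      qed
      have "(SUP y\<in>X. ereal (f x1 y)) \<le> (SUP y\<in>X. ereal (f x0 y))"
        using x1 x0(1) by (simp add: is_arg_min_linorder)
      also have "\<dots> \<le> ?s" unfolding real using x0(2) by (intro SUP_least) simp
      finally show ?thesis .
    next
      case PInf
      then show ?thesis by simp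
    next
      case MInf
      obtain x where "x \<in> X" using V(2) by blast
      then show ?thesis using SUP_upper[of x X "\<lambda>x. ereal (f x x)"] MInf by simp
    qed
    then show "\<exists>x0. is_arg_min (\<lambda>x. SUP y\<in>X. ereal (f x y)) (\<lambda>x. x \<in> X) x0 \<and>
        (SUP y\<in>X. ereal (f x0 y)) \<le> ?s"
      using x1 by blast
  qed
qed

end
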